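(* Let $(f_F,f_L)$ be a solution of the controlled leader-follower Boltzmann system described in the context, and put $\tilde\eta_L=\rho\,\eta_L$, $\tilde\eta_{FL}=\rho\,\eta_{FL}$. (a) If $R(\tilde w,\tilde v)=R(\tilde v,\tilde w)$ for all $\tilde w,\tilde v\in I=[-1,1]$, then the mean opinion of the leaders satisfies $$\frac{d}{dt}m_L(t)=\tilde\eta_L\psi\beta\,(w_d-m_L(t))+\tilde\eta_L\mu\beta\,(m_F(t)-m_L(t)).$$ (b) If moreover $P(w,v)=P(v,w)$ for all $w,v\in I$ and $S\equiv 1$, then the mean opinions satisfy the closed system $$\frac{d}{dt}m_L(t)=\tilde\eta_L\psi\beta\,(w_d-m_L(t))+\tilde\eta_L\mu\beta\,(m_F(t)-m_L(t)),\qquad \frac{d}{dt}m_F(t)=\tilde\eta_{FL}\,\alpha\,(m_L(t)-m_F(t)).$$ The exact solution of this system has the structure $$m_L(t)=C_1e^{-|\lambda_1|t}+C_2e^{-|\lambda_2|t}+w_d,$$ $$m_F(t)=C_1\left(1+\frac{\lambda_1}{\beta\mu\tilde\eta_L}\right)e^{-|\lambda_1|t}+C_2\left(1+\frac{\lambda_2}{\beta\mu\tilde\eta_L}\right)e^{-|\lambda_2|t}+w_d,$$ where $C_1,C_2$ depend on the initial data through $$C_1=-\frac{1}{\lambda_1-\lambda_2}\Big((\beta\tilde\eta_L+\lambda_2)m_L(0)-\mu\beta\tilde\eta_L m_F(0)-(\lambda_2+\beta\tilde\eta_L\psi)w_d\Big),$$ $$C_2=\frac{1}{\lambda_1-\lambda_2}\Big((\beta\tilde\eta_L+\lambda_1)m_L(0)-\mu\beta\tilde\eta_L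 m_F(0)-(\lambda_1+\beta\tilde\eta_L\psi)w_d\Big),$$ with $$\lambda_{1,2}=-\frac12\left(\alpha\tilde\eta_{FL}+\beta\tilde\eta_L\right)\pm\frac12\sqrt{(\alpha\tilde\eta_{FL}+\beta\tilde\eta_L)^2-4\psi\alpha\beta\tilde\eta_L\tilde\eta_{FL}}.$$ The numbers $\lambda_{1,2}$ are always negative. Hence the contribution of the initial averages $m_L(0),m_F(0)$ vanishes as time increases, and the mean opinions $m_L(t)$ and $m_F(t)$ of leaders and followers converge towards the desired state $w_d$.
   Context: Let $I=[-1,1]$. The parameters are: $\alpha>0$, $\nu>0$, $\beta=\frac{4\alpha^2}{\nu+4\alpha^2}$, constant relaxation rates $\eta_F,\eta_{FL},\eta_L>0$, leader mass $\rho\in(0,1]$, desired opinion $w_d\in I$, and nonnegative weights $\psi,\mu$ with $\psi+\mu=1$. The compromise functions $P,S,R$ on $I\times I$ take values in $[0,1]$, and the local diffusion functions $D,\hat D,\tilde D$ on $I$ take values in $[0,1]$. The random variables $\theta_1,\theta_2$ (variance $\sigma^2$), $\hat\theta$ (variance $\hat\sigma^2$) and $\tilde\theta_1,\tilde\theta_2$ (variance $\tilde\sigma^2$) have zero mean and finite variance, and $\langle\cdot\rangle$ denotes expectation with respect to them. For each $t\ge0$, $f_F(\cdot,t)$ (followers) and $f_L(\cdot,t)$ (leaders) are densities on $I$ with $\int_I f_F(w,t)\,dw=1$ and $\int_I f_L(\tilde w,t)\,d\tilde w=\rho$. The mean opinions are $$m_F(t)=\int_I w f_F(w,t)\,dw,\qquad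 m_L(t)=\frac1\rho\int_I\tilde w f_L(\tilde w,t)\,d\tilde w .$$ Binary interactions: (i) follower-follower: $$w^*=w+\alpha P(w,v)(v-w)+\theta_1D(w),\qquad v^*=v+\alpha P(v,w)(w-v)+\theta_2D(v);$$ (ii) leader-follower: $$w^{**}=w+\alpha S(w,\tilde v)(\tilde v-w)+\hat\theta\hat D(w),$$ with the leader's opinion $\tilde v$ unchanged; (iii) leader-leader: $$\tilde w^*=\tilde w+\alpha R(\tilde w,\tilde v)(\tilde v-\tilde w)+2\alpha u+\tilde\theta_1\tilde D(\tilde w),\qquad \tilde v^*=\tilde v+\alpha R(\tilde v,\tilde w)(\tilde w-\tilde v)+2\alpha u+\tilde\theta_2\tilde D(\tilde v),$$ with the feedback control $$2\alpha u=-\frac\beta2\Big[\psi\big((\tilde w-w_d)+(\tilde v-w_d)\big)+\mu\big((\tilde w-m_F)+(\tilde v-m_F)\big)\Big]-\frac{\alpha\beta}{2}\big(R(\tilde w,\tilde v)-R(\tilde v,\tilde w)\big)(\tilde v-\tilde w).$$ It is assumed that the interaction parameters are such that all post-interaction opinions lie in $I$. A solution of the Boltzmann system is a pair $(f_F,f_L)$ such that, for suitable test functions $\varphi$, $$\frac{d}{dt}\int_I\varphi(w)f_F(w,t)dw=\eta_F\Big\langle\int_{I^2}(\varphi(w^* )-\varphi(w))f_F(w,t)f_F(v,t)\,dw\,dv\Big\rangle+\eta_{FL}\Big\langle\int_{I^2}(\varphi(w^{**})-\varphi(w))f_F(w,t)f_L(\tilde v,t)\,dw\,d\tilde v\Big\rangle,$$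 $$\frac{d}{dt}\int_I\varphi(\tilde w)f_L(\tilde w,t)d\tilde w=\eta_L\Big\langle\int_{I^2}(\varphi(\tilde w^* )-\varphi(\tilde w))f_L(\tilde w,t)f_L(\tilde v,t)\,d\tilde w\,d\tilde v\Big\rangle.$$
   Formalization: In m_F the coefficient 1+λ/(βμη̃_L), wrong unless μ=1, is corrected to 1/μ+λ/(βμη̃_L); the m_F formula needs μ>0 and the m_L formula λ_1≠λ_2 (else division by 0); negativity of λ_{1,2} and convergence to w_d need ψ>0, since ψ=0 gives λ_1=0. *)

theory Defs
  imports "HOL-Probability.Probability"
begin

abbreviation opinions :: "real set" where
  "opinions \<equiv> {-1..1}"

abbreviation opinion_measure :: "real measure" where
  "opinion_measure \<equiv> restrict_space lborel opinions"

definition opinion_density :: "real \<Rightarrow> (real \<Rightarrow> real \<Rightarrow> real) \<Rightarrow> bool" where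
  "opinion_density m f \<longleftrightarrow> (\<forall>t\<ge>0.
     (\<forall>w\<in>opinions. f w t \<ge> 0) \<and>
     integrable opinion_measure (\<lambda>w. f w t) \<and>
     (LINT w|opinion_measure. f w t) = m)"

definition follower_mean :: "(real \<Rightarrow> real \<Rightarrow> real) \<Rightarrow> real \<Rightarrow> real" where
  "follower_mean fF t = (LINT w|opinion_measure. w * fF w t)"

definition leader_mean :: "real \<Rightarrow> (real \<Rightarrow> real \<Rightarrow> real) \<Rightarrow> real \<Rightarrow> real" where
  "leader_mean \<rho> fL t = (1 / \<rho>) * (LINT w|opinion_measure. w * fL w t)"

text \<open>Compromise functions and diffusion functions take values in the unit interval;
  measurability is what makes the collision integrals below meaningful.\<close>

definition compromise_function :: "(real \<Rightarrow> real \<Rightarrow> real) \<Rightarrow> bool" where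
  "compromise_function P \<longleftrightarrow>
     (\<lambda>(w, v). P w v) \<in> borel_measurable (opinion_measure \<Otimes>\<^sub>M opinion_measure) \<and>
     (\<forall>w\<in>opinions. \<forall>v\<in>opinions. P w v \<in> {0..1})"

definition diffusion_function :: "(real \<Rightarrow> real) \<Rightarrow> bool" where
  "diffusion_function D \<longleftrightarrow>
     D \<in> borel_measurable opinion_measure \<and> (\<forall>w\<in>opinions. D w \<in> {0..1})"

definition noise :: "'a measure \<Rightarrow> real \<Rightarrow> ('a \<Rightarrow> real) \<Rightarrow> bool" where
  "noise M \<sigma> \<theta> \<longleftrightarrow>
     integrable M \<theta> \<and> integrable M (\<lambda>\<omega>. (\<theta> \<omega>)\<^sup>2) \<and>
     prob_space.expectation M \<theta> = 0 \<and> prob_space.variance M \<theta> = \<sigma>\<^sup>2"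

text \<open>The opinion of an agent with opinion \<open>w\<close> after meeting an agent with opinion \<open>v\<close>.
  With the appropriate compromise function, diffusion function and noise value this is both the
  follower-follower and the leader-follower interaction; the leader-leader interaction
  additionally contains the control.\<close>

definition post_interaction ::
  "real \<Rightarrow> (real \<Rightarrow> real \<Rightarrow> real) \<Rightarrow> (real \<Rightarrow> real) \<Rightarrow> real \<Rightarrow> real \<Rightarrow> real \<Rightarrow> real" where
  "post_interaction \<alpha> P D \<theta> w v = w + \<alpha> * P w v * (v - w) + \<theta> * D w"

text \<open>The feedback law is a formula for \<open>2 * \<alpha> * u\<close>; this is \<open>u\<close>. The argument \<open>m\<close> is the current mean opinion of the followers.\<close>

definition leader_control ::
  "real \<Rightarrow> real \<Rightarrow> real \<Rightarrow> real \<Rightarrow> real \<Rightarrow> (real \<Rightarrow> real \<Rightarrow> real) \<Rightarrow> real \<Rightarrow> real \<Rightarrow> real \<Rightarrow> real" where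
  "leader_control \<alpha> \<beta> \<psi> \<mu> wd R m w v =
     (1 / (2 * \<alpha>)) *
       (- (\<beta> / 2) * (\<psi> * ((w - wd) + (v - wd)) + \<mu> * ((w - m) + (v - m)))
        - (\<alpha> * \<beta> / 2) * (R w v - R v w) * (v - w))"

definition controlled_post_interaction ::
  "real \<Rightarrow> real \<Rightarrow> (real \<Rightarrow> real \<Rightarrow> real) \<Rightarrow> (real \<Rightarrow> real) \<Rightarrow> real \<Rightarrow> real \<Rightarrow> real \<Rightarrow> real" where
  "controlled_post_interaction \<alpha> u R D \<theta> w v =
     w + \<alpha> * R w v * (v - w) + 2 * \<alpha> * u + \<theta> * D w"

text \<open>Smooth functions. Taking a small class of test functions makes the weak formulation
  a weaker requirement on the solution.\<close>

definition test_function :: "(real \<Rightarrow> real) \<Rightarrow> bool" where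
  "test_function \<phi> \<longleftrightarrow> (\<forall>k x. ((deriv ^^ k) \<phi>) field_differentiable (at x))"

definition collision_average ::
  "'a measure \<Rightarrow> ('a \<Rightarrow> real \<Rightarrow> real \<Rightarrow> real) \<Rightarrow> (real \<Rightarrow> real) \<Rightarrow> (real \<Rightarrow> real) \<Rightarrow> (real \<Rightarrow> real) \<Rightarrow> real" where
  "collision_average M post \<phi> f g =
     prob_space.expectation M
       (\<lambda>\<omega>. LINT (w, v)|(opinion_measure \<Otimes>\<^sub>M opinion_measure).
              (\<phi> (post \<omega> w v) - \<phi> w) * f w * g v)"

definition follower_boltzmann_equation ::
  "'a measure \<Rightarrow> real \<Rightarrow> real \<Rightarrow> real \<Rightarrow> (real \<Rightarrow> real \<Rightarrow> real) \<Rightarrow> (real \<Rightarrow> real \<Rightarrow> real) \<Rightarrow>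
   (real \<Rightarrow> real) \<Rightarrow> (real \<Rightarrow> real) \<Rightarrow> ('a \<Rightarrow> real) \<Rightarrow> ('a \<Rightarrow> real) \<Rightarrow>
   (real \<Rightarrow> real \<Rightarrow> real) \<Rightarrow> (real \<Rightarrow> real \<Rightarrow> real) \<Rightarrow> bool" where
  "follower_boltzmann_equation M \<alpha> \<eta>F \<eta>FL P S D Dh \<theta>1 \<theta>h fF fL \<longleftrightarrow>
     (\<forall>\<phi>. test_function \<phi> \<longrightarrow> (\<forall>t\<ge>0.
        ((\<lambda>s. LINT w|opinion_measure. \<phi> w * fF w s) has_real_derivative
           (\<eta>F * collision_average M (\<lambda>\<omega>. post_interaction \<alpha> P D (\<theta>1 \<omega>)) \<phi>
                   (\<lambda>w. fF w t) (\<lambda>v. fF v t)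
          + \<eta>FL * collision_average M (\<lambda>\<omega>. post_interaction \<alpha> S Dh (\<theta>h \<omega>)) \<phi>
                   (\<lambda>w. fF w t) (\<lambda>v. fL v t)))
          (at t within {0..})))"

definition leader_boltzmann_equation ::
  "'a measure \<Rightarrow> real \<Rightarrow> real \<Rightarrow> real \<Rightarrow> real \<Rightarrow> real \<Rightarrow> real \<Rightarrow> (real \<Rightarrow> real \<Rightarrow> real) \<Rightarrow>
   (real \<Rightarrow> real) \<Rightarrow> ('a \<Rightarrow> real) \<Rightarrow>
   (real \<Rightarrow> real \<Rightarrow> real) \<Rightarrow> (real \<Rightarrow> real \<Rightarrow> real) \<Rightarrow> bool" where
  "leader_boltzmann_equation M \<alpha> \<beta> \<psi> \<mu> wd \<eta>L R Dt \<theta>t1 fF fL \<longleftrightarrow>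
     (\<forall>\<phi>. test_function \<phi> \<longrightarrow> (\<forall>t\<ge>0.
        ((\<lambda>s. LINT w|opinion_measure. \<phi> w * fL w s) has_real_derivative
           (\<eta>L * collision_average M
                   (\<lambda>\<omega> w v. controlled_post_interaction \<alpha>
                      (leader_control \<alpha> \<beta> \<psi> \<mu> wd R (follower_mean fF t) w v) R Dt (\<theta>t1 \<omega>) w v)
                   \<phi> (\<lambda>w. fL w t) (\<lambda>v. fL v t)))
          (at t within {0..})))"

end

theory Submission
  imports Defs
begin

text \<open>
  Testing the two Boltzmann equations with the identity, which is smooth, yields the time
  derivatives of the first moments. In the collision averages the centred noise disappears
  (\<open>collision_average_identity\<close>). A symmetric compromise function contributes nothing, since the
  integrand \<open>K w v * (v - w)\<close> is antisymmetric and both agents have the same density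
  (\<open>symmetric_compromise_integral_zero\<close>). What is left of either drift is affine in the two
  opinions, so its integral is a combination of masses and means, and the means solve a linear
  system.

  Centred at \<open>wd\<close>, that system is \<open>x' = a * (\<mu> * y - x)\<close>, \<open>y' = b * (x - y)\<close> with
  \<open>a = \<beta> * \<eta>tL\<close> and \<open>b = \<alpha> * \<eta>tFL\<close>; its matrix has trace \<open>- (a + b)\<close> and determinant
  \<open>a * b * (1 - \<mu>) = \<psi> * a * b\<close>, and its eigenvalues are \<open>lam1\<close> and \<open>lam2\<close>. The discriminant
  \<open>(a - b)\<^sup>2 + 4 * \<mu> * a * b\<close> shows that they are real, and distinct for \<open>\<mu> > 0\<close>; written as
  \<open>(a + b)\<^sup>2 - 4 * \<psi> * a * b\<close>, it shows that they are nonpositive, and negative for \<open>\<psi> > 0\<close>. Each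
  of the two left eigenforms \<open>(a + lam2) * x - a * \<mu> * y\<close> and \<open>(a + lam1) * x - a * \<mu> * y\<close> evolves
  by its own exponential (\<open>left_eigenform_solution\<close>), with initial values
  \<open>- (lam1 - lam2) * C1\<close> and \<open>(lam1 - lam2) * C2\<close>; subtracting them isolates \<open>x\<close>, and then \<open>\<mu> * y\<close>
  follows.

  For \<open>\<mu> = 0\<close> these forms do not determine \<open>y\<close>, and for \<open>\<mu> = 0\<close>, \<open>a = b\<close> the matrix is a
  Jordan block. Convergence to \<open>wd\<close> therefore does not go through the explicit solution: a
  quadratic Lyapunov function decays exponentially whenever \<open>\<psi> > 0\<close> (\<open>leader_follower_decay\<close>).
\<close>

section \<open>The weak formulation tested with the identity\<close>

lemma funpow_deriv_const:
  "((deriv ^^ k) (\<lambda>_. c :: real)) field_differentiable at x"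
proof (induction k arbitrary: c)
  case (Suc k)
  have "deriv (\<lambda>_. c :: real) = (\<lambda>_. 0)"
    by auto
  then show ?case
    using Suc[of 0] by (simp add: funpow_Suc_right del: funpow.simps)
qed (simp add: field_differentiable_const)

lemma test_function_identity: "test_function (\<lambda>w. w)"
  unfolding test_function_def
proof (intro allI)
  fix k and x :: real
  have "deriv (\<lambda>w. w :: real) = (\<lambda>_. 1)"
    by auto
  then show "((deriv ^^ k) (\<lambda>w. w)) field_differentiable at x"
    using funpow_deriv_const[of _ 1 x]
    by (cases k) (simp_all add: funpow_Suc_right field_differentiable_ident del: funpow.simps(2))
qed

section \<open>Integration against a pair of densities\<close>

lemma pair_sigma_finite_opinion: "pair_sigma_finite opinion_measure opinion_measure"
proof -
  interpret sigma_finite_measure opinion_measure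
    by (intro sigma_finite_measure_restrict_space sigma_finite_lborel) simp
  show ?thesis ..
qed

lemma (in pair_sigma_finite)
  fixes h k :: "_ \<Rightarrow> real"
  assumes h: "integrable M1 h" and k: "integrable M2 k"
  shows integrable_pair_product: "integrable (M1 \<Otimes>\<^sub>M M2) (\<lambda>(x, y). h x * k y)"
    and integral_pair_product:
      "(LINT (x, y)|(M1 \<Otimes>\<^sub>M M2). h x * k y) = integral\<^sup>L M1 h * integral\<^sup>L M2 k"
proof -
  have [measurable]: "h \<in> borel_measurable M1" "k \<in> borel_measurable M2"
    using h k by auto
  show *: "integrable (M1 \<Otimes>\<^sub>M M2) (\<lambda>(x, y). h x * k y)"
    by (rule Fubini_integrable) (use h k in \<open>simp_all add: abs_mult\<close>)
  show "(LINT (x, y)|(M1 \<Otimes>\<^sub>M M2). h x * k y) = integral\<^sup>L M1 h * integral\<^sup>L M2 k"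
    using integral_fst[OF *] by simp
qed

lemma integrable_bounded_mult:
  fixes h f :: "'b \<Rightarrow> real"
  assumes f: "integrable N f" and h: "h \<in> borel_measurable N"
    and bound: "\<And>x. x \<in> space N \<Longrightarrow> \<bar>h x\<bar> \<le> B"
  shows "integrable N (\<lambda>x. h x * f x)"
proof (rule Bochner_Integration.integrable_bound)
  show "integrable N (\<lambda>x. B * f x)"
    using f by simp
  show "(\<lambda>x. h x * f x) \<in> borel_measurable N"
    using borel_measurable_times[OF h borel_measurable_integrable[OF f]] .
  show "AE x in N. norm (h x * f x) \<le> norm (B * f x)"
    using AE_space
  proof eventually_elim
    case (elim x)
    from bound[OF elim] show ?case
      by (simp add: abs_mult mult_right_mono)
  qed
qed

lemma integrable_opinion_moment:
  assumes "integrable opinion_measure f"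
  shows "integrable opinion_measure (\<lambda>w. w * f w)"
  by (rule integrable_bounded_mult[where B = 1, OF assms])
     (auto simp: space_restrict_space intro!: measurable_restrict_space1)

lemma integrable_drift_density:
  fixes B :: real
  assumes f: "integrable opinion_measure f" and g: "integrable opinion_measure g"
    and K: "(\<lambda>(w, v). K w v) \<in> borel_measurable (opinion_measure \<Otimes>\<^sub>M opinion_measure)"
    and bound: "\<And>w v. w \<in> opinions \<Longrightarrow> v \<in> opinions \<Longrightarrow> \<bar>K w v\<bar> \<le> B"
  shows "integrable (opinion_measure \<Otimes>\<^sub>M opinion_measure) (\<lambda>(w, v). K w v * (f w * g v))"
proof -
  interpret pair_sigma_finite opinion_measure opinion_measure
    by (rule pair_sigma_finite_opinion)
  have "integrable (opinion_measure \<Otimes>\<^sub>M opinion_measure)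
          (\<lambda>x. (case x of (w, v) \<Rightarrow> K w v) * (case x of (w, v) \<Rightarrow> f w * g v))"
    by (rule integrable_bounded_mult[where B = B, OF integrable_pair_product[OF f g] K])
       (auto simp: space_pair_measure space_restrict_space bound)
  then show ?thesis
    by (simp add: case_prod_unfold)
qed

lemma affine_drift_integral:
  assumes f: "integrable opinion_measure f" and g: "integrable opinion_measure g"
  shows "integrable (opinion_measure \<Otimes>\<^sub>M opinion_measure)
           (\<lambda>(w, v). (A + B * w + C * v) * (f w * g v))" (is ?int)
    and "(LINT (w, v)|(opinion_measure \<Otimes>\<^sub>M opinion_measure).
            (A + B * w + C * v) * (f w * g v))
       = A * ((LINT w|opinion_measure. f w) * (LINT v|opinion_measure. g v))
         + B * ((LINT w|opinion_measure. w * f w) * (LINT v|opinion_measure. g v))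
         + C * ((LINT w|opinion_measure. f w) * (LINT v|opinion_measure. v * g v))" (is ?eq)
proof -
  interpret pair_sigma_finite opinion_measure opinion_measure
    by (rule pair_sigma_finite_opinion)
  note f1 = integrable_opinion_moment[OF f] and g1 = integrable_opinion_moment[OF g]
  note int = integrable_pair_product[OF f g] integrable_pair_product[OF f1 g]
    integrable_pair_product[OF f g1]
  note eq = integral_pair_product[OF f g] integral_pair_product[OF f1 g]
    integral_pair_product[OF f g1]
  have split: "(\<lambda>(w, v). (A + B * w + C * v) * (f w * g v)) =
      (\<lambda>x. A * (case x of (w, v) \<Rightarrow> f w * g v) + B * (case x of (w, v) \<Rightarrow> w * f w * g v)
         + C * (case x of (w, v) \<Rightarrow> f w * (v * g v)))"
    by (auto simp: fun_eq_iff algebra_simps)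
  show ?int
    unfolding split using int by (intro Bochner_Integration.integrable_add integrable_mult_right) auto
  show ?eq
    unfolding split using int by (simp add: eq)
qed

text \<open>Exchanging the two agents changes the sign of the integrand and, both having the same
  density, preserves the measure.\<close>

lemma symmetric_compromise_integral_zero:
  assumes K: "(\<lambda>(w, v). K w v) \<in> borel_measurable (opinion_measure \<Otimes>\<^sub>M opinion_measure)"
    and f: "integrable opinion_measure f"
    and sym: "\<And>w v. w \<in> opinions \<Longrightarrow> v \<in> opinions \<Longrightarrow> K w v = K v w"
  shows "(LINT (w, v)|(opinion_measure \<Otimes>\<^sub>M opinion_measure). K w v * (v - w) * (f w * f v)) = 0"
    (is "?I = 0")
proof -
  interpret pair_sigma_finite opinion_measure opinion_measure
    by (rule pair_sigma_finite_opinion)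
  have [measurable]: "f \<in> borel_measurable opinion_measure"
    using f by auto
  have [measurable]: "(\<lambda>w. w) \<in> borel_measurable opinion_measure"
    by (rule measurable_restrict_space1) simp
  note K[measurable]
  have meas: "(\<lambda>(w, v). K w v * (v - w) * (f w * f v))
      \<in> borel_measurable (opinion_measure \<Otimes>\<^sub>M opinion_measure)"
    by measurable
  have "?I = (LINT (w, v)|(opinion_measure \<Otimes>\<^sub>M opinion_measure). K v w * (w - v) * (f v * f w))"
    using integral_product_swap[OF meas] by (simp add: case_prod_unfold)
  also have "\<dots> = (LINT (w, v)|(opinion_measure \<Otimes>\<^sub>M opinion_measure).
      - (K w v * (v - w) * (f w * f v)))"
    by (rule Bochner_Integration.integral_cong)
       (auto simp: space_pair_measure space_restrict_space sym algebra_simps)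
  also have "\<dots> = - ?I"
    by (simp add: case_prod_unfold)
  finally show ?thesis
    by simp
qed

section \<open>Mean opinion changes in binary collisions\<close>

text \<open>The opinion change is affine in the noise value, and its coefficients are integrable against
  the pair of densities. So the collision integral is affine in the noise value too, and a centred
  noise disappears upon taking the expectation.\<close>

lemma collision_average_identity:
  assumes "prob_space M" and noise: "noise M \<sigma> \<theta>" and D: "diffusion_function D"
    and f: "integrable opinion_measure f" and g: "integrable opinion_measure g"
    and K: "integrable (opinion_measure \<Otimes>\<^sub>M opinion_measure) (\<lambda>(w, v). K w v * (f w * g v))"
    and post: "\<And>\<omega> w v. w \<in> opinions \<Longrightarrow> v \<in> opinions \<Longrightarrow>
        post \<omega> w v = w + K w v + \<theta> \<omega> * D w"
  shows "collision_average M post (\<lambda>w. w) f g =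
     (LINT (w, v)|(opinion_measure \<Otimes>\<^sub>M opinion_measure). K w v * (f w * g v))"
    (is "_ = ?I")
proof -
  interpret prob_space M by fact
  interpret op: pair_sigma_finite opinion_measure opinion_measure
    by (rule pair_sigma_finite_opinion)
  have theta: "integrable M \<theta>" "expectation \<theta> = 0"
    using noise by (auto simp: noise_def)
  have Df: "integrable opinion_measure (\<lambda>w. D w * f w)"
    by (rule integrable_bounded_mult[where B = 1, OF f])
       (use D in \<open>auto simp: diffusion_function_def space_restrict_space\<close>)
  define d where "d = (LINT (w, v)|(opinion_measure \<Otimes>\<^sub>M opinion_measure). (D w * f w) * g v)"
  have "(LINT (w, v)|(opinion_measure \<Otimes>\<^sub>M opinion_measure).
           (post \<omega> w v - w) * f w * g v) = ?I + \<theta> \<omega> * d" for \<omega>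
  proof -
    have "(LINT (w, v)|(opinion_measure \<Otimes>\<^sub>M opinion_measure). (post \<omega> w v - w) * f w * g v) =
      (LINT x|(opinion_measure \<Otimes>\<^sub>M opinion_measure).
         (case x of (w, v) \<Rightarrow> K w v * (f w * g v)) + \<theta> \<omega> * (case x of (w, v) \<Rightarrow> (D w * f w) * g v))"
      by (rule Bochner_Integration.integral_cong)
         (auto simp: space_pair_measure space_restrict_space post algebra_simps)
    also have "\<dots> = ?I + \<theta> \<omega> * d"
      using K op.integrable_pair_product[OF Df g] by (simp add: d_def)
    finally show ?thesis .
  qed
  then show ?thesis
    unfolding collision_average_def using theta by (simp add: prob_space)
qed

lemma integrable_compromise_drift:
  assumes "compromise_function P"
    and "integrable opinion_measure f" and "integrable opinion_measure g"
  shows "integrable (opinion_measure \<Otimes>\<^sub>M opinion_measure)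
           (\<lambda>(w, v). \<alpha> * P w v * (v - w) * (f w * g v))"
proof (rule integrable_drift_density[where B = "\<bar>\<alpha>\<bar> * 2"])
  have [measurable]: "(\<lambda>w. w) \<in> borel_measurable opinion_measure"
    by (rule measurable_restrict_space1) simp
  have [measurable]: "(\<lambda>(w, v). P w v) \<in> borel_measurable (opinion_measure \<Otimes>\<^sub>M opinion_measure)"
    using assms(1) by (simp add: compromise_function_def)
  show "(\<lambda>(w, v). \<alpha> * P w v * (v - w)) \<in> borel_measurable (opinion_measure \<Otimes>\<^sub>M opinion_measure)"
    by measurable
  fix w v :: real
  assume wv: "w \<in> opinions" "v \<in> opinions"
  then have "0 \<le> P w v" "P w v \<le> 1"
    using assms(1) by (auto simp: compromise_function_def)
  moreover have "\<bar>v - w\<bar> \<le> 2"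
    using wv by auto
  ultimately have "P w v * \<bar>v - w\<bar> \<le> 1 * 2"
    by (intro mult_mono) auto
  with \<open>0 \<le> P w v\<close> show "\<bar>\<alpha> * P w v * (v - w)\<bar> \<le> \<bar>\<alpha>\<bar> * 2"
    by (simp add: abs_mult mult.assoc mult_left_mono)
qed (use assms in auto)

lemma symmetric_collision_average_zero:
  assumes "prob_space M" "noise M \<sigma> \<theta>" "diffusion_function D"
    and P: "compromise_function P" and f: "integrable opinion_measure f"
    and sym: "\<And>w v. w \<in> opinions \<Longrightarrow> v \<in> opinions \<Longrightarrow> P w v = P v w"
  shows "collision_average M (\<lambda>\<omega>. post_interaction \<alpha> P D (\<theta> \<omega>)) (\<lambda>w. w) f f = 0"
proof -
  have "(\<lambda>(w, v). \<alpha> * P w v) \<in> borel_measurable (opinion_measure \<Otimes>\<^sub>M opinion_measure)"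
    using P borel_measurable_times[OF borel_measurable_const[of \<alpha>]]
    by (auto simp: compromise_function_def case_prod_unfold)
  from symmetric_compromise_integral_zero[OF this f] show ?thesis
    by (subst collision_average_identity[OF assms(1-3) f f integrable_compromise_drift[OF P f f]])
       (auto simp: post_interaction_def sym)
qed

lemma full_compromise_collision_average:
  assumes "prob_space M" "noise M \<sigma> \<theta>" "diffusion_function D"
    and f: "integrable opinion_measure f" and g: "integrable opinion_measure g"
    and one: "\<And>w v. w \<in> opinions \<Longrightarrow> v \<in> opinions \<Longrightarrow> S w v = 1"
  shows "collision_average M (\<lambda>\<omega>. post_interaction \<alpha> S D (\<theta> \<omega>)) (\<lambda>w. w) f g =
     \<alpha> * ((LINT w|opinion_measure. f w) * (LINT v|opinion_measure. v * g v)
          - (LINT w|opinion_measure. w * f w) * (LINT v|opinion_measure. g v))"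
  using affine_drift_integral[OF f g, of 0 "- \<alpha>" \<alpha>]
  by (subst collision_average_identity[OF assms(1-3) f g,
        where K = "\<lambda>w v. 0 + - \<alpha> * w + \<alpha> * v"])
     (auto simp: post_interaction_def one algebra_simps)

text \<open>For symmetric \<open>R\<close> the last summand of the feedback law vanishes. What remains of the
  control is affine in the two opinions, and depends on the targets only through their weighted
  average.\<close>

lemma controlled_collision_average:
  assumes "prob_space M" "noise M \<sigma> \<theta>" "diffusion_function D"
    and R: "compromise_function R" and f: "integrable opinion_measure f"
    and sym: "\<And>w v. w \<in> opinions \<Longrightarrow> v \<in> opinions \<Longrightarrow> R w v = R v w"
    and \<alpha>: "\<alpha> \<noteq> 0" and weights: "\<psi> + \<mu> = 1"
  shows "collision_average M
      (\<lambda>\<omega> w v. controlled_post_interaction \<alpha> (leader_control \<alpha> \<beta> \<psi> \<mu> wd R m w v) R D (\<theta> \<omega>) w v)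
      (\<lambda>w. w) f f =
     \<beta> * (LINT w|opinion_measure. f w) *
       ((\<psi> * wd + \<mu> * m) * (LINT w|opinion_measure. f w) - (LINT w|opinion_measure. w * f w))"
proof -
  define A where "A = \<beta> * (\<psi> * wd + \<mu> * m)"
  define K where "K = (\<lambda>w v. \<alpha> * R w v * (v - w) + (A + - (\<beta> / 2) * w + - (\<beta> / 2) * v))"
  have \<mu>: "\<mu> = 1 - \<psi>"
    using weights by simp
  have "(\<lambda>(w, v). \<alpha> * R w v) \<in> borel_measurable (opinion_measure \<Otimes>\<^sub>M opinion_measure)"
    using R borel_measurable_times[OF borel_measurable_const[of \<alpha>]]
    by (auto simp: compromise_function_def case_prod_unfold)
  note zero = symmetric_compromise_integral_zero[OF this f]
  note comp = integrable_compromise_drift[OF R f f, of \<alpha>]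
  note aff = affine_drift_integral[OF f f, of A "- (\<beta> / 2)" "- (\<beta> / 2)"]
  have split: "(\<lambda>(w, v). K w v * (f w * f v)) =
      (\<lambda>x. (case x of (w, v) \<Rightarrow> \<alpha> * R w v * (v - w) * (f w * f v))
         + (case x of (w, v) \<Rightarrow> (A + - (\<beta> / 2) * w + - (\<beta> / 2) * v) * (f w * f v)))"
    by (auto simp: fun_eq_iff K_def algebra_simps)
  have int: "integrable (opinion_measure \<Otimes>\<^sub>M opinion_measure) (\<lambda>(w, v). K w v * (f w * f v))"
    unfolding split using comp aff(1) by (rule Bochner_Integration.integrable_add)
  have post: "controlled_post_interaction \<alpha> (leader_control \<alpha> \<beta> \<psi> \<mu> wd R m w v) R D z w v =
      w + K w v + z * D w" if "w \<in> opinions" "v \<in> opinions" for z w v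
    using \<alpha> sym[OF that]
    by (simp add: controlled_post_interaction_def leader_control_def K_def A_def \<mu> field_simps)
  have "(LINT (w, v)|(opinion_measure \<Otimes>\<^sub>M opinion_measure). K w v * (f w * f v)) =
     A * ((LINT w|opinion_measure. f w) * (LINT w|opinion_measure. f w))
       + - (\<beta> / 2) * ((LINT w|opinion_measure. w * f w) * (LINT w|opinion_measure. f w))
       + - (\<beta> / 2) * ((LINT w|opinion_measure. f w) * (LINT w|opinion_measure. w * f w))"
    unfolding split Bochner_Integration.integral_add[OF comp aff(1)] aff(2)
    using zero sym by simp
  moreover have "collision_average M
      (\<lambda>\<omega> w v. controlled_post_interaction \<alpha> (leader_control \<alpha> \<beta> \<psi> \<mu> wd R m w v) R D (\<theta> \<omega>) w v)
      (\<lambda>w. w) f f =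
      (LINT (w, v)|(opinion_measure \<Otimes>\<^sub>M opinion_measure). K w v * (f w * f v))"
    by (rule collision_average_identity[OF assms(1-3) f f int post])
  ultimately show ?thesis
    by (simp add: A_def algebra_simps)
qed

section \<open>The linear system for the means\<close>

lemma exponential_ode_solution:
  fixes u :: "real \<Rightarrow> real"
  assumes u: "\<And>t. t \<ge> 0 \<Longrightarrow> (u has_real_derivative l * u t) (at t within {0..})"
    and "t \<ge> 0"
  shows "u t = u 0 * exp (l * t)"
proof -
  have "\<exists>c. \<forall>t\<in>{0..}. u t * exp (- l * t) = c"
    by (rule has_field_derivative_zero_constant)
       (auto intro!: derivative_eq_intros u simp: algebra_simps)
  then have "u t * exp (- l * t) = u 0 * exp (- l * 0)"
    using \<open>t \<ge> 0\<close> by (metis atLeast_iff order_refl)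
  then show ?thesis
    by (simp add: exp_minus field_simps)
qed

lemma exponential_decay:
  fixes c :: real
  assumes "c > 0"
  shows "((\<lambda>t. C * exp (- c * t)) \<longlongrightarrow> 0) at_top"
proof -
  have "filterlim (\<lambda>t. - c * t) at_bot at_top"
    by (rule filterlim_tendsto_neg_mult_at_bot[OF tendsto_const _ filterlim_ident]) (use assms in simp)
  from filterlim_compose[OF exp_at_bot this] show ?thesis
    by (rule tendsto_mult_right_zero)
qed

text \<open>The linear form with coefficients \<open>(a + l', - a * \<mu>)\<close> is a left eigenvector of the system
  matrix for the eigenvalue \<open>l\<close>. Unlike the eigenvector \<open>(1, 1 / \<mu> + l / (a * \<mu>))\<close> it involves
  no division, so \<open>\<mu> = 0\<close> is no exception.\<close>

lemma left_eigenform_solution: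
  fixes x y :: "real \<Rightarrow> real"
  assumes x: "\<And>t. t \<ge> 0 \<Longrightarrow> (x has_real_derivative a * (\<mu> * y t - x t)) (at t within {0..})"
    and y: "\<And>t. t \<ge> 0 \<Longrightarrow> (y has_real_derivative b * (x t - y t)) (at t within {0..})"
    and trace: "l + l' = - (a + b)" and det: "l * l' = a * b * (1 - \<mu>)"
    and t: "t \<ge> 0"
  shows "(a + l') * x t - a * \<mu> * y t = ((a + l') * x 0 - a * \<mu> * y 0) * exp (l * t)"
proof (rule exponential_ode_solution[OF _ t])
  fix t :: real
  assume "t \<ge> 0"
  have l: "l = - (a + b) - l'"
    using trace by simp
  have "(a + l') * (a * (\<mu> * y t - x t)) - a * \<mu> * (b * (x t - y t)) =
        l * ((a + l') * x t - a * \<mu> * y t)"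
    using det unfolding l by algebra
  then show "((\<lambda>t. (a + l') * x t - a * \<mu> * y t) has_real_derivative
      l * ((a + l') * x t - a * \<mu> * y t)) (at t within {0..})"
    by (auto intro!: derivative_eq_intros x y \<open>t \<ge> 0\<close> simp: mult.commute)
qed

text \<open>The weights in \<open>b * x\<^sup>2 + a * y\<^sup>2\<close> make its dissipation rate
  \<open>2 * a * b * (x\<^sup>2 - (1 + \<mu>) * x * y + y\<^sup>2)\<close>, a symmetric form that is positive definite for
  \<open>0 \<le> \<mu> < 1\<close>. No case distinction on the eigenvalues is made, so a double eigenvalue is
  covered as well.\<close>

lemma leader_follower_decay:
  fixes x y :: "real \<Rightarrow> real"
  assumes x: "\<And>t. t \<ge> 0 \<Longrightarrow> (x has_real_derivative a * (\<mu> * y t - x t)) (at t within {0..})"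
    and y: "\<And>t. t \<ge> 0 \<Longrightarrow> (y has_real_derivative b * (x t - y t)) (at t within {0..})"
    and a: "a > 0" and b: "b > 0" and \<mu>: "0 \<le> \<mu>" "\<mu> < 1"
  shows "(x \<longlongrightarrow> 0) at_top" and "(y \<longlongrightarrow> 0) at_top"
proof -
  define c where "c = min a b * (1 - \<mu>)"
  define V where "V = (\<lambda>t. b * (x t)\<^sup>2 + a * (y t)\<^sup>2)"
  have c: "c > 0"
    using a b \<mu> by (simp add: c_def)
  have dissipation: "c * (b * p\<^sup>2 + a * q\<^sup>2) \<le> 2 * a * b * (p\<^sup>2 - (1 + \<mu>) * p * q + q\<^sup>2)" for p q
  proof -
    \<comment> \<open>\<open>p\<^sup>2 - (1 + \<mu>) * p * q + q\<^sup>2\<close> is \<open>(1 - \<mu>) / 2 * (p\<^sup>2 + q\<^sup>2) + (1 + \<mu>) / 2 * (p - q)\<^sup>2\<close>\<close>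
    have "c * (b * p\<^sup>2) \<le> a * (1 - \<mu>) * (b * p\<^sup>2)" "c * (a * q\<^sup>2) \<le> b * (1 - \<mu>) * (a * q\<^sup>2)"
      unfolding c_def using a b \<mu> by (intro mult_right_mono; simp)+
    moreover have "0 \<le> a * b * (1 + \<mu>) * (p - q)\<^sup>2"
      using a b \<mu> by simp
    ultimately show ?thesis
      by (simp add: power2_eq_square algebra_simps)
  qed
  define V' where "V' = (\<lambda>t. - 2 * a * b * ((x t)\<^sup>2 - (1 + \<mu>) * x t * y t + (y t)\<^sup>2))"
  have V: "((\<lambda>t. V t * exp (c * t)) has_real_derivative (V' t + c * V t) * exp (c * t))
      (at t within {0..})" if "t \<ge> 0" for t
    unfolding V_def V'_def
    by (rule derivative_eq_intros x y that refl)+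
       (simp add: power2_eq_square algebra_simps)
  have decay: "V t \<le> V 0 * exp (- c * t)" if "t \<ge> 0" for t
  proof -
    have "V t * exp (c * t) \<le> V 0 * exp (c * 0)"
    proof (rule DERIV_nonpos_imp_decreasing_open[OF that])
      show "\<exists>z. ((\<lambda>t. V t * exp (c * t)) has_real_derivative z) (at s) \<and> z \<le> 0"
        if "0 < s" "s < t" for s
      proof (intro exI conjI)
        show "((\<lambda>t. V t * exp (c * t)) has_real_derivative (V' s + c * V s) * exp (c * s)) (at s)"
          using V[of s] that at_within_interior[of s "{0..}"] by simp
        show "(V' s + c * V s) * exp (c * s) \<le> 0"
          using dissipation[of "x s" "y s"] by (simp add: V_def V'_def mult_le_0_iff)
      qed
      show "continuous_on {0..t} (\<lambda>t. V t * exp (c * t))"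
        by (rule continuous_on_subset[of "{0..}"])
           (auto intro!: DERIV_continuous_on V)
    qed
    then show ?thesis
      by (simp add: exp_minus field_simps)
  qed
  have V0: "(V \<longlongrightarrow> 0) at_top"
  proof (rule tendsto_sandwich[OF _ _ tendsto_const exponential_decay[OF c]])
    show "\<forall>\<^sub>F t in at_top. 0 \<le> V t"
      using a b by (simp add: V_def)
    show "\<forall>\<^sub>F t in at_top. V t \<le> V 0 * exp (- c * t)"
      using eventually_ge_at_top[of 0] by eventually_elim (rule decay)
  qed
  have null: "(z \<longlongrightarrow> 0) at_top"
    if k: "k > 0" and bound: "\<And>t. k * (z t)\<^sup>2 \<le> V t" for z :: "real \<Rightarrow> real" and k
  proof -
    have "((\<lambda>t. sqrt (V t / k)) \<longlongrightarrow> 0) at_top"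
      using tendsto_real_sqrt[OF tendsto_divide[OF V0 tendsto_const[of k]]] k by simp
    moreover have "\<bar>z t\<bar> \<le> sqrt (V t / k)" for t
      using k bound[of t] by (intro real_le_rsqrt) (simp add: field_simps)
    ultimately show ?thesis
      by (intro Lim_null_comparison[where f = z]) auto
  qed
  show "(x \<longlongrightarrow> 0) at_top" "(y \<longlongrightarrow> 0) at_top"
    by (rule null[OF b], use a in \<open>simp add: V_def\<close>) (rule null[OF a], use b in \<open>simp add: V_def\<close>)
qed

theorem mainTheorem1:
  fixes \<alpha> \<nu> \<beta> \<eta>F \<eta>FL \<eta>L \<rho> wd \<psi> \<mu> \<sigma> \<sigma>h \<sigma>t :: real
    and P S R :: "real \<Rightarrow> real \<Rightarrow> real"
    and D Dh Dt :: "real \<Rightarrow> real"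
    and M :: "'a measure"
    and \<theta>1 \<theta>2 \<theta>h \<theta>t1 \<theta>t2 :: "'a \<Rightarrow> real"
    and fF fL :: "real \<Rightarrow> real \<Rightarrow> real"
    and mF mL :: "real \<Rightarrow> real"
    and \<eta>tL \<eta>tFL lam1 lam2 C1 C2 :: real
  assumes "\<alpha> > 0" and "\<nu> > 0" and "\<beta> = 4 * \<alpha>\<^sup>2 / (\<nu> + 4 * \<alpha>\<^sup>2)"
    and "\<eta>F > 0" and "\<eta>FL > 0" and "\<eta>L > 0"
    and "0 < \<rho>" and "\<rho> \<le> 1" and "wd \<in> opinions"
    and "\<psi> \<ge> 0" and "\<mu> \<ge> 0" and "\<psi> + \<mu> = 1"
    and "compromise_function P" and "compromise_function S" and "compromise_function R"
    and "diffusion_function D" and "diffusion_function Dh" and "diffusion_function Dt"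
    and "prob_space M"
    and "noise M \<sigma> \<theta>1" and "noise M \<sigma> \<theta>2" and "noise M \<sigma>h \<theta>h"
    and "noise M \<sigma>t \<theta>t1" and "noise M \<sigma>t \<theta>t2"
    and "opinion_density 1 fF" and "opinion_density \<rho> fL"
    and "mF = follower_mean fF" and "mL = leader_mean \<rho> fL"
    and "\<forall>w\<in>opinions. \<forall>v\<in>opinions. AE \<omega> in M.
           post_interaction \<alpha> P D (\<theta>1 \<omega>) w v \<in> opinions \<and>
           post_interaction \<alpha> P D (\<theta>2 \<omega>) v w \<in> opinions"
    and "\<forall>w\<in>opinions. \<forall>v\<in>opinions. AE \<omega> in M.
           post_interaction \<alpha> S Dh (\<theta>h \<omega>) w v \<in> opinions"
    and "\<forall>t\<ge>0. \<forall>w\<in>opinions. \<forall>v\<in>opinions. AE \<omega> in M.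
           (let u = leader_control \<alpha> \<beta> \<psi> \<mu> wd R (mF t) w v
            in controlled_post_interaction \<alpha> u R Dt (\<theta>t1 \<omega>) w v \<in> opinions \<and>
               controlled_post_interaction \<alpha> u R Dt (\<theta>t2 \<omega>) v w \<in> opinions)"
    and "follower_boltzmann_equation M \<alpha> \<eta>F \<eta>FL P S D Dh \<theta>1 \<theta>h fF fL"
    and "leader_boltzmann_equation M \<alpha> \<beta> \<psi> \<mu> wd \<eta>L R Dt \<theta>t1 fF fL"
    and "\<eta>tL = \<rho> * \<eta>L" and "\<eta>tFL = \<rho> * \<eta>FL"
    and "lam1 = - (1/2) * (\<alpha> * \<eta>tFL + \<beta> * \<eta>tL)
              + (1/2) * sqrt ((\<alpha> * \<eta>tFL + \<beta> * \<eta>tL)\<^sup>2 - 4 * \<psi> * \<alpha> * \<beta> * \<eta>tL * \<eta>tFL)"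
    and "lam2 = - (1/2) * (\<alpha> * \<eta>tFL + \<beta> * \<eta>tL)
              - (1/2) * sqrt ((\<alpha> * \<eta>tFL + \<beta> * \<eta>tL)\<^sup>2 - 4 * \<psi> * \<alpha> * \<beta> * \<eta>tL * \<eta>tFL)"
    and "C1 = - (1 / (lam1 - lam2)) *
              ((\<beta> * \<eta>tL + lam2) * mL 0 - \<mu> * \<beta> * \<eta>tL * mF 0 - (lam2 + \<beta> * \<eta>tL * \<psi>) * wd)"
    and "C2 = (1 / (lam1 - lam2)) *
              ((\<beta> * \<eta>tL + lam1) * mL 0 - \<mu> * \<beta> * \<eta>tL * mF 0 - (lam1 + \<beta> * \<eta>tL * \<psi>) * wd)"
  shows
    "((\<forall>w\<in>opinions. \<forall>v\<in>opinions. R w v = R v w) \<longrightarrow>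
       (\<forall>t\<ge>0. (mL has_real_derivative
          (\<eta>tL * \<psi> * \<beta> * (wd - mL t) + \<eta>tL * \<mu> * \<beta> * (mF t - mL t))) (at t within {0..})))
     \<and>
     ((\<forall>w\<in>opinions. \<forall>v\<in>opinions. R w v = R v w) \<and>
      (\<forall>w\<in>opinions. \<forall>v\<in>opinions. P w v = P v w) \<and>
      (\<forall>w\<in>opinions. \<forall>v\<in>opinions. S w v = 1) \<longrightarrow>
       (\<forall>t\<ge>0.
          (mL has_real_derivative
             (\<eta>tL * \<psi> * \<beta> * (wd - mL t) + \<eta>tL * \<mu> * \<beta> * (mF t - mL t))) (at t within {0..}) \<and>
          (mF has_real_derivative (\<eta>tFL * \<alpha> * (mL t - mF t))) (at t within {0..})) \<and>
       (lam1 \<noteq> lam2 \<longrightarrow> (\<forall>t\<ge>0.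
          mL t = C1 * exp (- \<bar>lam1\<bar> * t) + C2 * exp (- \<bar>lam2\<bar> * t) + wd)) \<and>
       (\<mu> > 0 \<longrightarrow> (\<forall>t\<ge>0.
          mF t = C1 * (1 / \<mu> + lam1 / (\<beta> * \<mu> * \<eta>tL)) * exp (- \<bar>lam1\<bar> * t)
               + C2 * (1 / \<mu> + lam2 / (\<beta> * \<mu> * \<eta>tL)) * exp (- \<bar>lam2\<bar> * t) + wd)) \<and>
       (\<psi> > 0 \<longrightarrow>
          ((\<lambda>t. C1 * exp (- \<bar>lam1\<bar> * t) + C2 * exp (- \<bar>lam2\<bar> * t)) \<longlongrightarrow> 0) at_top \<and>
          ((\<lambda>t. C1 * (1 / \<mu> + lam1 / (\<beta> * \<mu> * \<eta>tL)) * exp (- \<bar>lam1\<bar> * t)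
               + C2 * (1 / \<mu> + lam2 / (\<beta> * \<mu> * \<eta>tL)) * exp (- \<bar>lam2\<bar> * t)) \<longlongrightarrow> 0) at_top \<and>
          (mL \<longlongrightarrow> wd) at_top \<and> (mF \<longlongrightarrow> wd) at_top))
     \<and>
     (\<mu> > 0 \<longrightarrow> lam1 \<noteq> lam2)
     \<and>
     (\<psi> > 0 \<longrightarrow> lam1 < 0 \<and> lam2 < 0)"
proof -
  interpret prob_space M by fact
  have fF: "integrable opinion_measure (\<lambda>w. fF w t)" "(LINT w|opinion_measure. fF w t) = 1"
    and fL: "integrable opinion_measure (\<lambda>w. fL w t)" "(LINT w|opinion_measure. fL w t) = \<rho>"
    if "t \<ge> 0" for t
    using that \<open>opinion_density 1 fF\<close> \<open>opinion_density \<rho> fL\<close> by (auto simp: opinion_density_def)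
  have mL_moment: "(LINT w|opinion_measure. w * fL w t) = \<rho> * mL t" for t
    using \<open>mL = leader_mean \<rho> fL\<close> \<open>0 < \<rho>\<close> by (simp add: leader_mean_def)
  have mF_moment: "(LINT w|opinion_measure. w * fF w t) = mF t" for t
    using \<open>mF = follower_mean fF\<close> by (simp add: follower_mean_def)
  define a where "a = \<beta> * \<eta>tL"
  define b where "b = \<alpha> * \<eta>tFL"
  have "\<beta> > 0"
    using \<open>\<alpha> > 0\<close> \<open>\<nu> > 0\<close> unfolding \<open>\<beta> = _\<close> by (intro divide_pos_pos add_pos_pos) auto
  then have a: "a > 0" and b: "b > 0"
    using \<open>\<alpha> > 0\<close> \<open>\<eta>L > 0\<close> \<open>\<eta>FL > 0\<close> \<open>0 < \<rho>\<close> by (auto simp: a_def b_def \<open>\<eta>tL = _\<close> \<open>\<eta>tFL = _\<close>)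
  have \<psi>: "\<psi> = 1 - \<mu>"
    using \<open>\<psi> + \<mu> = 1\<close> by simp

  have leaders: "(mL has_real_derivative
      (\<eta>tL * \<psi> * \<beta> * (wd - mL t) + \<eta>tL * \<mu> * \<beta> * (mF t - mL t))) (at t within {0..})"
    if R: "\<forall>w\<in>opinions. \<forall>v\<in>opinions. R w v = R v w" and t: "t \<ge> 0" for t
  proof -
    have "((\<lambda>s. LINT w|opinion_measure. w * fL w s) has_real_derivative
        \<eta>L * (\<beta> * \<rho> * ((\<psi> * wd + \<mu> * mF t) * \<rho> - \<rho> * mL t))) (at t within {0..})"
    proof -
      have "collision_average M
          (\<lambda>\<omega> w v. controlled_post_interaction \<alpha>
             (leader_control \<alpha> \<beta> \<psi> \<mu> wd R (follower_mean fF t) w v) R Dt (\<theta>t1 \<omega>) w v)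
          (\<lambda>w. w) (\<lambda>w. fL w t) (\<lambda>v. fL v t) =
        \<beta> * \<rho> * ((\<psi> * wd + \<mu> * mF t) * \<rho> - \<rho> * mL t)"
        using controlled_collision_average[OF \<open>prob_space M\<close> \<open>noise M \<sigma>t \<theta>t1\<close>
            \<open>diffusion_function Dt\<close> \<open>compromise_function R\<close> fL(1)[OF t] _ _ \<open>\<psi> + \<mu> = 1\<close>,
            of \<alpha> \<beta> wd "follower_mean fF t"] R \<open>\<alpha> > 0\<close>
        by (simp add: fL(2)[OF t] mL_moment \<open>mF = follower_mean fF\<close>)
      then show ?thesis
        using \<open>leader_boltzmann_equation M \<alpha> \<beta> \<psi> \<mu> wd \<eta>L R Dt \<theta>t1 fF fL\<close>[
            unfolded leader_boltzmann_equation_def, rule_format, OF test_function_identity t]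
        by (simp only:)
    qed
    from DERIV_cmult[OF this, of "1 / \<rho>"] show ?thesis
      unfolding mL_moment using \<open>0 < \<rho>\<close> by (simp add: \<psi> \<open>\<eta>tL = _\<close> algebra_simps)
  qed

  have followers: "(mF has_real_derivative (\<eta>tFL * \<alpha> * (mL t - mF t))) (at t within {0..})"
    if P: "\<forall>w\<in>opinions. \<forall>v\<in>opinions. P w v = P v w"
      and S: "\<forall>w\<in>opinions. \<forall>v\<in>opinions. S w v = 1" and t: "t \<ge> 0" for t
  proof -
    have FF: "collision_average M (\<lambda>\<omega>. post_interaction \<alpha> P D (\<theta>1 \<omega>)) (\<lambda>w. w)
        (\<lambda>w. fF w t) (\<lambda>v. fF v t) = 0"
      using P by (intro symmetric_collision_average_zero[OF \<open>prob_space M\<close> \<open>noise M \<sigma> \<theta>1\<close>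
          \<open>diffusion_function D\<close> \<open>compromise_function P\<close> fF(1)[OF t]]) auto
    have FL: "collision_average M (\<lambda>\<omega>. post_interaction \<alpha> S Dh (\<theta>h \<omega>)) (\<lambda>w. w)
        (\<lambda>w. fF w t) (\<lambda>v. fL v t) = \<alpha> * (\<rho> * mL t - mF t * \<rho>)"
      using full_compromise_collision_average[OF \<open>prob_space M\<close> \<open>noise M \<sigma>h \<theta>h\<close>
          \<open>diffusion_function Dh\<close> fF(1)[OF t] fL(1)[OF t], of S \<alpha>] S
      by (simp add: fF(2)[OF t] fL(2)[OF t] mL_moment mF_moment)
    have "((\<lambda>s. LINT w|opinion_measure. w * fF w s) has_real_derivative
        \<eta>F * 0 + \<eta>FL * (\<alpha> * (\<rho> * mL t - mF t * \<rho>))) (at t within {0..})"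
      using \<open>follower_boltzmann_equation M \<alpha> \<eta>F \<eta>FL P S D Dh \<theta>1 \<theta>h fF fL\<close>[
          unfolded follower_boltzmann_equation_def, rule_format, OF test_function_identity t]
      by (simp only: FF FL)
    then show ?thesis
      unfolding mF_moment by (simp add: \<open>\<eta>tFL = _\<close> algebra_simps)
  qed

  have disc: "(\<alpha> * \<eta>tFL + \<beta> * \<eta>tL)\<^sup>2 - 4 * \<psi> * \<alpha> * \<beta> * \<eta>tL * \<eta>tFL = (a - b)\<^sup>2 + 4 * \<mu> * a * b"
    by (simp add: a_def b_def \<psi> power2_eq_square algebra_simps)
  define s where "s = sqrt ((a - b)\<^sup>2 + 4 * \<mu> * a * b)"
  have lam1: "lam1 = (- (a + b) + s) / 2" and lam2: "lam2 = (- (a + b) - s) / 2"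
    unfolding \<open>lam1 = _\<close> \<open>lam2 = _\<close> disc s_def by (simp_all add: a_def b_def field_simps)
  have s2: "s\<^sup>2 = (a - b)\<^sup>2 + 4 * \<mu> * a * b" and s0: "s \<ge> 0"
    unfolding s_def using a b \<open>\<mu> \<ge> 0\<close> by auto
  have trace: "lam1 + lam2 = - (a + b)"
    by (simp add: lam1 lam2 field_simps)
  have det: "lam1 * lam2 = a * b * (1 - \<mu>)"
    using s2 by (simp add: lam1 lam2 power2_eq_square field_simps)
  have distinct: "lam1 \<noteq> lam2" if "\<mu> > 0"
  proof -
    have "s > 0"
      unfolding s_def using that a b by (intro real_sqrt_gt_zero add_nonneg_pos) auto
    then show ?thesis
      by (simp add: lam1 lam2)
  qed
  have s_le: "s\<^sup>2 = (a + b)\<^sup>2 - 4 * \<psi> * (a * b)"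
    unfolding s2 \<psi> by (simp add: power2_eq_square algebra_simps)
  have nonpos: "lam1 \<le> 0" "lam2 \<le> 0"
  proof -
    have "s \<le> a + b"
      by (rule power2_le_imp_le) (use a b \<open>\<psi> \<ge> 0\<close> s_le in auto)
    then show "lam1 \<le> 0" "lam2 \<le> 0"
      using s0 a b by (auto simp: lam1 lam2)
  qed
  have neg: "lam1 < 0 \<and> lam2 < 0" if "\<psi> > 0"
  proof -
    have "s < a + b"
      by (rule power2_less_imp_less) (use a b that s_le in auto)
    then show ?thesis
      using s0 a b by (auto simp: lam1 lam2)
  qed
  have transient: "((\<lambda>t. c1 * exp (- \<bar>lam1\<bar> * t) + c2 * exp (- \<bar>lam2\<bar> * t)) \<longlongrightarrow> 0) at_top"
    if "\<psi> > 0" for c1 c2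
  proof -
    have "\<bar>lam1\<bar> > 0" "\<bar>lam2\<bar> > 0"
      using neg[OF that] by auto
    from tendsto_add[OF exponential_decay[OF this(1)] exponential_decay[OF this(2)]] show ?thesis
      by simp
  qed

  have solution:
    "lam1 \<noteq> lam2 \<Longrightarrow> t \<ge> 0 \<Longrightarrow>
       mL t = C1 * exp (- \<bar>lam1\<bar> * t) + C2 * exp (- \<bar>lam2\<bar> * t) + wd"
    "\<mu> > 0 \<Longrightarrow> t \<ge> 0 \<Longrightarrow>
       mF t = C1 * (1 / \<mu> + lam1 / (\<beta> * \<mu> * \<eta>tL)) * exp (- \<bar>lam1\<bar> * t)
            + C2 * (1 / \<mu> + lam2 / (\<beta> * \<mu> * \<eta>tL)) * exp (- \<bar>lam2\<bar> * t) + wd"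
    "\<psi> > 0 \<Longrightarrow> (mL \<longlongrightarrow> wd) at_top" "\<psi> > 0 \<Longrightarrow> (mF \<longlongrightarrow> wd) at_top"
    if R: "\<forall>w\<in>opinions. \<forall>v\<in>opinions. R w v = R v w"
      and P: "\<forall>w\<in>opinions. \<forall>v\<in>opinions. P w v = P v w"
      and S: "\<forall>w\<in>opinions. \<forall>v\<in>opinions. S w v = 1" for t
  proof -
    define x where "x = (\<lambda>t. mL t - wd)"
    define y where "y = (\<lambda>t. mF t - wd)"
    have x: "(x has_real_derivative a * (\<mu> * y t - x t)) (at t within {0..})" if "t \<ge> 0" for t
      unfolding x_def y_def
      by (rule derivative_eq_intros leaders[OF R that] refl)+
         (simp add: a_def \<psi> algebra_simps)
    have y: "(y has_real_derivative b * (x t - y t)) (at t within {0..})" if "t \<ge> 0" for t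
      unfolding x_def y_def
      by (rule derivative_eq_intros followers[OF P S that] refl)+
         (simp add: b_def algebra_simps)
    define E1 where "E1 = exp (- \<bar>lam1\<bar> * t)"
    define E2 where "E2 = exp (- \<bar>lam2\<bar> * t)"
    have C1: "- (lam1 - lam2) * C1 = (a + lam2) * x 0 - a * \<mu> * y 0"
      and C2: "(lam1 - lam2) * C2 = (a + lam1) * x 0 - a * \<mu> * y 0" if "lam1 \<noteq> lam2"
    proof -
      have cancel: "- d * (- (1 / d) * X) = X" "d * (1 / d * X) = X" if "d \<noteq> 0" for d X :: real
        using that by simp_all
      have nz: "lam1 - lam2 \<noteq> 0"
        using that by simp
      show "- (lam1 - lam2) * C1 = (a + lam2) * x 0 - a * \<mu> * y 0"
        unfolding \<open>C1 = _\<close> cancel(1)[OF nz]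
        by (simp add: x_def y_def a_def \<psi> algebra_simps)
      show "(lam1 - lam2) * C2 = (a + lam1) * x 0 - a * \<mu> * y 0"
        unfolding \<open>C2 = _\<close> cancel(2)[OF nz]
        by (simp add: x_def y_def a_def \<psi> algebra_simps)
    qed
    \<comment> \<open>The eigenvalues are nonpositive, so \<open>- \<bar>lam1\<bar>\<close> is \<open>lam1\<close> and \<open>- \<bar>lam2\<bar>\<close> is \<open>lam2\<close>.\<close>
    have form1: "(a + lam2) * x t - a * \<mu> * y t = - (lam1 - lam2) * C1 * E1"
      if "lam1 \<noteq> lam2" "t \<ge> 0"
      using left_eigenform_solution[OF x y trace det \<open>t \<ge> 0\<close>] nonpos
      by (simp only: C1[OF that(1)] E1_def abs_of_nonpos minus_minus)
    have form2: "(a + lam1) * x t - a * \<mu> * y t = (lam1 - lam2) * C2 * E2"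
      if "lam1 \<noteq> lam2" "t \<ge> 0"
    proof -
      have "lam2 + lam1 = - (a + b)" "lam2 * lam1 = a * b * (1 - \<mu>)"
        using trace det by (simp_all add: add.commute mult.commute)
      from left_eigenform_solution[OF x y this \<open>t \<ge> 0\<close>] show ?thesis
        using nonpos by (simp only: C2[OF that(1)] E2_def abs_of_nonpos minus_minus)
    qed
    have xt: "x t = C1 * E1 + C2 * E2" if "lam1 \<noteq> lam2" "t \<ge> 0"
    proof -
      have "(lam1 - lam2) * x t = (lam1 - lam2) * (C1 * E1 + C2 * E2)"
        using form1[OF that] form2[OF that] by (simp add: algebra_simps)
      with that(1) show ?thesis
        by simp
    qed
    show "mL t = C1 * exp (- \<bar>lam1\<bar> * t) + C2 * exp (- \<bar>lam2\<bar> * t) + wd"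
      if "lam1 \<noteq> lam2" "t \<ge> 0"
      using xt[OF that] by (simp add: x_def E1_def E2_def)
    show "mF t = C1 * (1 / \<mu> + lam1 / (\<beta> * \<mu> * \<eta>tL)) * exp (- \<bar>lam1\<bar> * t)
            + C2 * (1 / \<mu> + lam2 / (\<beta> * \<mu> * \<eta>tL)) * exp (- \<bar>lam2\<bar> * t) + wd"
      if "\<mu> > 0" "t \<ge> 0"
    proof -
      have "a * \<mu> * y t = (a + lam1) * C1 * E1 + (a + lam2) * C2 * E2"
        using form2[OF distinct] xt[OF distinct] that by (simp add: algebra_simps)
      then have "y t = ((a + lam1) * C1 * E1 + (a + lam2) * C2 * E2) / (a * \<mu>)"
        using a \<open>\<mu> > 0\<close> by (simp add: eq_divide_eq mult.commute)
      also have "\<dots> = C1 * (1 / \<mu> + lam1 / (a * \<mu>)) * E1 + C2 * (1 / \<mu> + lam2 / (a * \<mu>)) * E2"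
        using a \<open>\<mu> > 0\<close> by (simp add: field_simps)
      finally show ?thesis
        by (simp add: y_def E1_def E2_def a_def ac_simps)
    qed
    show "(mL \<longlongrightarrow> wd) at_top" "(mF \<longlongrightarrow> wd) at_top" if "\<psi> > 0"
    proof -
      have "\<mu> < 1"
        using that \<psi> by simp
      note decay = leader_follower_decay[OF x y a b \<open>\<mu> \<ge> 0\<close> this]
      show "(mL \<longlongrightarrow> wd) at_top" "(mF \<longlongrightarrow> wd) at_top"
        using decay by (simp_all add: x_def y_def LIM_zero_iff)
    qed
  qed

  show ?thesis
    using leaders followers solution transient distinct neg by simp
qed

end
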